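(* Consider a continuous map $F: I\times\overline{B}(0,R)\to \operatorname{int}\left(I\times\overline{B}(0,R)\right)$, where $I\subset\mathbb{R}$ is a closed interval and $\overline{B}(0,R)\subset\mathbb{R}^{N-1}$ is a closed ball of radius $R$. Denote points of $I\times\overline{B}(0,R)$ by $(x,y)$. Suppose that $F$ has an $n$-periodic point $(x_0,y_0)\in\mathbb{R}\times\mathbb{R}^{N-1}$ with least period $n$, and denote its orbit by $\{(x_0,y_0),\ (x_1,y_1)=F(x_0,y_0),\ \dots,\ (x_{n-1},y_{n-1})=F^{n-1}(x_0,y_0),\ (x_n,y_n)=(x_0,y_0)\}\subset \operatorname{int} I\times\overline{B}(0,R)$. Suppose that there exist $\delta_0,\delta_1,\dots,\delta_{n-1}>0$ (with $\delta_n=\delta_0$) such that $$\forall\, i\in\{0,\dots,n-1\}:\qquad F\left([x_i-\delta_i,x_i+\delta_i]\times\overline{B}(0,R)\right)\subset (x_{i+1}-\delta_{i+1},x_{i+1}+\delta_{i+1})\times B(0,R).$$ Then for every natural number $m$ succeeding $n$ in the Sharkovskii order, $F$ has a point with least period $m$.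
   Context: $B(0,R)$ and $\overline{B}(0,R)$ denote the open and closed balls of radius $R$ centered at $0$ in $\mathbb{R}^{N-1}$, and $\operatorname{int}$ denotes the topological interior. The Sharkovskii order $\triangleleft$ on the natural numbers is $$3\triangleleft 5\triangleleft 7\triangleleft 9\triangleleft\dots\triangleleft 2\cdot3\triangleleft 2\cdot5\triangleleft 2\cdot7\triangleleft\dots\triangleleft 2^2\cdot3\triangleleft 2^2\cdot5\triangleleft 2^2\cdot7\triangleleft\dots\triangleleft 2^3\cdot 3\triangleleft 2^3\cdot 5\triangleleft 2^3\cdot7\triangleleft\dots\ \dots\triangleleft 2^{k+1}\triangleleft 2^k\triangleleft 2^{k-1}\triangleleft\dots\triangleleft 2^2\triangleleft 2\triangleleft 1 .$$ "$m$ succeeds $n$" means $n\triangleleft m$.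
   Formalization: The intervals [x_i−δ_i, x_i+δ_i], i<n, are additionally assumed pairwise disjoint (without this the claim fails, e.g. n=3, m=2, for a clamped order-3 linear map with overlapping strips), and contained in I, so that F is defined on the strips. *)

theory Defs
  imports "HOL-Analysis.Analysis"
begin

definition has_least_period :: "('a \<Rightarrow> 'a) \<Rightarrow> nat \<Rightarrow> 'a \<Rightarrow> bool" where
  "has_least_period f n p \<longleftrightarrow>
     0 < n \<and> (f ^^ n) p = p \<and> (\<forall>k. 0 < k \<and> k < n \<longrightarrow> (f ^^ k) p \<noteq> p)"

(* Every positive number is uniquely 2^a * p with p odd. The three disjuncts compare two numbers
   that are not powers of two (first by exponent, then by odd part), put every such number before
   every power of two, and order the powers of two decreasingly. The order is strict, with 3 as its
   first element and 1 as its last; 0 is related to nothing. *)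
definition sharkovskii :: "nat \<Rightarrow> nat \<Rightarrow> bool" (infix "\<triangleleft>" 50) where
  "n \<triangleleft> m \<longleftrightarrow>
     (\<exists>a p b q. n = 2 ^ a * p \<and> odd p \<and> m = 2 ^ b * q \<and> odd q \<and>
        (p > 1 \<and> q > 1 \<and> (a < b \<or> a = b \<and> p < q) \<or>
         p > 1 \<and> q = 1 \<or>
         p = 1 \<and> q = 1 \<and> a > b))"

end

theory Submission
  imports Defs
begin

text \<open>The fibres over the intervals between neighbourhoods of orbit points cover one another in the
  horizontal direction exactly as the intervals spanned by the orbit points do for the permutation of the
  orbit. A cyclic chain of such coverings is followed by a periodic orbit: the equations \<open>F (p i) = p (i + 1)\<close>
  for all points of the chain form one system on a box, which is solvable by the Poincare--Miranda
  theorem. It remains to find, for each length \<open>m\<close> that succeeds \<open>n\<close>, a chain of length \<open>m\<close> whose first interval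
  meets none of the others, which forces the least period to be \<open>m\<close>. As in the proof of Sharkovskii's theorem
  by Burns and Hasselblatt, either every orbit point switches sides of the centre, and one passes to every second
  orbit point and halves \<open>n\<close> and \<open>m\<close>, or a shortest chain from the centre to a point that does not switch
  gives all lengths above \<open>n\<close> and all even lengths.\<close>

section \<open>The Poincare--Miranda theorem\<close>

lemma tendsto_fun_iff:
  fixes f :: "'c \<Rightarrow> 'i \<Rightarrow> 'a::topological_space"
  shows "(f \<longlongrightarrow> l) F \<longleftrightarrow> (\<forall>i. ((\<lambda>c. f c i) \<longlongrightarrow> l i) F)"
  using limitin_componentwise[of "\<lambda>_. euclidean" UNIV f l F]
  by (simp add: euclidean_product_topology)

text \<open>Tychonoff's theorem: the index type may be infinite.\<close>

lemma compact_box_fun: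
  fixes a b :: "'i \<Rightarrow> real"
  shows "compact {x. \<forall>i. x i \<in> {a i..b i}}"
proof -
  have "compactin (product_topology (\<lambda>_. euclidean) UNIV) (PiE UNIV (\<lambda>i. {a i..b i}))"
    by (simp add: compactin_PiE)
  moreover have "PiE UNIV (\<lambda>i. {a i..b i}) = {x. \<forall>i. x i \<in> {a i..b i}}"
    by (auto simp: PiE_def Pi_def)
  ultimately show ?thesis
    by (simp add: euclidean_product_topology)
qed

text \<open>Kuhn's combinatorial lemma yields, on ever finer grids, a cell at whose corners each of
  the \<open>n\<close> components takes both signs. A limit point of these cells is a zero by
  continuity.\<close>

lemma poincare_miranda_unit_cube:
  fixes f :: "(nat \<Rightarrow> real) \<Rightarrow> nat \<Rightarrow> real"
  defines "Q \<equiv> {x. \<forall>i. x i \<in> {0..1}}"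
  assumes cont: "\<And>i. i < n \<Longrightarrow> continuous_on Q (\<lambda>x. f x i)"
    and lo: "\<And>x i. x \<in> Q \<Longrightarrow> i < n \<Longrightarrow> x i = 0 \<Longrightarrow> f x i \<ge> 0"
    and hi: "\<And>x i. x \<in> Q \<Longrightarrow> i < n \<Longrightarrow> x i = 1 \<Longrightarrow> f x i \<le> 0"
  shows "\<exists>x\<in>Q. \<forall>i<n. f x i = 0"
proof -
  \<comment> \<open>Grid point of mesh \<open>1 / Suc k\<close>; the coordinates from
    \<open>n\<close> on are frozen at 0.\<close>
  define pt where "pt k u = (\<lambda>i. if i < n then real (u i) / real (Suc k) else 0)" for k :: nat and u :: "nat \<Rightarrow> nat"
  have ptQ: "pt k u \<in> Q" if "\<forall>i<n. u i \<le> Suc k" for k u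
    using that by (auto simp: pt_def Q_def divide_simps)
  define near where "near q r \<longleftrightarrow> (\<forall>j<n. q j \<le> r j \<and> r j \<le> q j + 1)" for q r :: "nat \<Rightarrow> nat"
  have "\<exists>q. (\<forall>i<n. q i < Suc k) \<and> (\<forall>i<n. \<exists>r s. near q r \<and> near q s \<and> f (pt k r) i \<ge> 0 \<and> f (pt k s) i \<le> 0)" for k
  proof -
    \<comment> \<open>Kuhn's lemma prescribes the labels on opposite faces, the sign of
      \<open>f\<close> decides elsewhere. By \<open>lo\<close> and \<open>hi\<close> the prescribed
      labels agree with the signs there.\<close>
    define label where "label u i = (if u i = 0 \<or> u i \<noteq> Suc k \<and> f (pt k u) i \<ge> 0 then 0 else 1::nat)" for u i
    have l0: "f (pt k u) i \<ge> 0" if "label u i = 0" "\<forall>i<n. u i \<le> Suc k" "i < n" for u i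
      using that lo[OF ptQ[OF that(2)] \<open>i < n\<close>] by (auto simp: label_def pt_def split: if_splits)
    have l1: "f (pt k u) i \<le> 0" if "label u i \<noteq> 0" "\<forall>i<n. u i \<le> Suc k" "i < n" for u i
      using that hi[OF ptQ[OF that(2)] \<open>i < n\<close>] by (auto simp: label_def pt_def split: if_splits)
    obtain q where q: "\<forall>i<n. q i < Suc k" and
      lab: "\<forall>i<n. \<exists>r s. (\<forall>j<n. q j \<le> r j \<and> r j \<le> q j + 1) \<and> (\<forall>j<n. q j \<le> s j \<and> s j \<le> q j + 1) \<and> label r i \<noteq> label s i"
      by (rule kuhn_lemma[of "Suc k" n label]) (auto simp: label_def)
    have "\<exists>r s. near q r \<and> near q s \<and> f (pt k r) i \<ge> 0 \<and> f (pt k s) i \<le> 0" if "i < n" for i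
    proof -
      obtain r s where rs: "near q r" "near q s" "label r i \<noteq> label s i"
        using lab \<open>i < n\<close> unfolding near_def by blast
      have b: "\<forall>i<n. r i \<le> Suc k" "\<forall>i<n. s i \<le> Suc k"
        using rs(1,2) q unfolding near_def by fastforce+
      show ?thesis
      proof (cases "label r i = 0")
        case True
        then show ?thesis using rs l0[OF _ b(1) \<open>i<n\<close>] l1[OF _ b(2) \<open>i<n\<close>] by auto
      next
        case False
        then have "label s i = 0" using rs(3) by (auto simp: label_def split: if_splits)
        then show ?thesis using False rs l0[OF _ b(2) \<open>i<n\<close>] l1[OF _ b(1) \<open>i<n\<close>] by auto
      qed
    qed
    then show ?thesis using q by blast
  qed
  then obtain q where q: "\<And>k i. i < n \<Longrightarrow> q k i < Suc k"
    and q': "\<And>k i. i < n \<Longrightarrow> \<exists>r s. near (q k) r \<and> near (q k) s \<and> f (pt k r) i \<ge> 0 \<and> f (pt k s) i \<le> 0"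
    by metis
  have "seq_compact Q"
    unfolding Q_def using compact_imp_seq_compact compact_box_fun[of "\<lambda>_. 0" "\<lambda>_. 1"] by blast
  moreover have "\<forall>k. pt k (q k) \<in> Q"
    using q ptQ by (meson less_imp_le)
  ultimately obtain z \<sigma> where z: "z \<in> Q" "strict_mono \<sigma>" and lim: "((\<lambda>k. pt k (q k)) \<circ> \<sigma>) \<longlonglongrightarrow> z"
    using seq_compactE by metis
  \<comment> \<open>The cells shrink, so any choice of corners converges to the same
    \<open>z\<close>.\<close>
  have close: "(\<lambda>k. pt (\<sigma> k) (r (\<sigma> k))) \<longlonglongrightarrow> z" if r: "\<And>k. near (q k) (r k)" for r
    unfolding tendsto_fun_iff
  proof
    fix i
    have "(\<lambda>k. pt (\<sigma> k) (q (\<sigma> k)) i) \<longlonglongrightarrow> z i"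
      using lim unfolding tendsto_fun_iff by simp
    moreover have "(\<lambda>k. pt (\<sigma> k) (r (\<sigma> k)) i - pt (\<sigma> k) (q (\<sigma> k)) i) \<longlonglongrightarrow> 0"
    proof (rule Lim_null_comparison)
      show "\<forall>\<^sub>F k in sequentially. norm (pt (\<sigma> k) (r (\<sigma> k)) i - pt (\<sigma> k) (q (\<sigma> k)) i) \<le> inverse (real (Suc (\<sigma> k)))"
      proof (rule always_eventually, rule allI)
        fix k
        have "i < n \<Longrightarrow> \<bar>real (r (\<sigma> k) i) - real (q (\<sigma> k) i)\<bar> \<le> 1"
          using r[of "\<sigma> k"] unfolding near_def by fastforce
        then show "norm (pt (\<sigma> k) (r (\<sigma> k)) i - pt (\<sigma> k) (q (\<sigma> k)) i) \<le> inverse (real (Suc (\<sigma> k)))"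
          by (auto simp: pt_def abs_divide inverse_eq_divide simp flip: diff_divide_distrib
              intro!: divide_right_mono)
      qed
      show "(\<lambda>k. inverse (real (Suc (\<sigma> k)))) \<longlonglongrightarrow> 0"
        using LIMSEQ_subseq_LIMSEQ[OF LIMSEQ_inverse_real_of_nat z(2)] by (simp add: o_def)
    qed
    ultimately show "(\<lambda>k. pt (\<sigma> k) (r (\<sigma> k)) i) \<longlonglongrightarrow> z i"
      using tendsto_add by fastforce
  qed
  have "f z i = 0" if "i < n" for i
  proof -
    have "\<forall>k. \<exists>r. near (q k) r \<and> 0 \<le> f (pt k r) i"
      and "\<forall>k. \<exists>s. near (q k) s \<and> f (pt k s) i \<le> 0"
      using q'[OF that] by blast+
    then obtain r s where rs: "\<And>k. near (q k) (r k)" "\<And>k. near (q k) (s k)"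
      "\<And>k. f (pt k (r k)) i \<ge> 0" "\<And>k. f (pt k (s k)) i \<le> 0"
      by (auto dest!: choice)
    have conv: "(\<lambda>k. f (pt (\<sigma> k) (r (\<sigma> k))) i) \<longlonglongrightarrow> f z i" if r: "\<And>k. near (q k) (r k)" for r
    proof (rule continuous_on_tendsto_compose[OF cont[OF \<open>i < n\<close>] close[OF r] \<open>z \<in> Q\<close>])
      show "\<forall>\<^sub>F k in sequentially. pt (\<sigma> k) (r (\<sigma> k)) \<in> Q"
      proof (rule always_eventually, rule allI, rule ptQ, intro allI impI)
        fix k j assume "j < n"
        then show "r (\<sigma> k) j \<le> Suc (\<sigma> k)"
          using q[of j "\<sigma> k"] r[of "\<sigma> k"] unfolding near_def by fastforce
      qed
    qed
    have "f z i \<ge> 0"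
      using LIMSEQ_le_const[OF conv[OF rs(1)], of 0] rs(3) by auto
    moreover have "f z i \<le> 0"
      using LIMSEQ_le_const2[OF conv[OF rs(2)], of 0] rs(4) by auto
    ultimately show ?thesis by simp
  qed
  then show ?thesis using z(1) by blast
qed

text \<open>Reduction to the unit cube by enumerating \<open>S\<close> and rescaling affinely;
  coordinates outside \<open>S\<close> stay at \<open>a i\<close>.\<close>

theorem poincare_miranda:
  fixes f :: "('i \<Rightarrow> real) \<Rightarrow> 'i \<Rightarrow> real" and a b :: "'i \<Rightarrow> real"
  defines "Q \<equiv> {x. \<forall>i. x i \<in> {a i..b i}}"
  assumes S: "finite S" and ab: "\<And>i. a i \<le> b i"
    and cont: "\<And>i. i \<in> S \<Longrightarrow> continuous_on (Q) (\<lambda>x. f x i)"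
    and lo: "\<And>x i. x \<in> Q \<Longrightarrow> i \<in> S \<Longrightarrow> x i = a i \<Longrightarrow> f x i \<ge> 0"
    and hi: "\<And>x i. x \<in> Q \<Longrightarrow> i \<in> S \<Longrightarrow> x i = b i \<Longrightarrow> f x i \<le> 0"
  shows "\<exists>x\<in>Q. \<forall>i\<in>S. f x i = 0"
proof -
  obtain h where h: "bij_betw h {..<card S} S"
    using ex_bij_betw_nat_finite[OF S] unfolding atLeast0LessThan by blast
  define g where "g = the_inv_into {..<card S} h"
  have gh: "g (h j) = j" if "j < card S" for j
    using that h by (auto simp: g_def bij_betw_def the_inv_into_f_f)
  have hg: "h (g i) = i" "g i < card S" if "i \<in> S" for i
    using that h by (auto simp: g_def bij_betw_def f_the_inv_into_f dest: the_inv_into_into[of h])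
  define y where "y X = (\<lambda>i. a i + (if i \<in> S then (b i - a i) * X (g i) else 0))" for X :: "nat \<Rightarrow> real"
  define U where "U = {X::nat\<Rightarrow>real. \<forall>i. X i \<in> {0..1}}"
  have yQ: "y X \<in> Q" if "X \<in> U" for X
  proof -
    have "a i + (b i - a i) * X (g i) \<le> b i" for i
      using mult_left_le[of "X (g i)" "b i - a i"] that ab[of i] by (auto simp: U_def)
    then show ?thesis using that ab by (auto simp: y_def U_def Q_def)
  qed
  have coord: "continuous_on U (\<lambda>X. X k)" for k
    using continuous_on_product_then_coordinatewise[OF continuous_on_id] .
  have ycont: "continuous_on U y"
    unfolding y_def
  proof (rule continuous_on_coordinatewise_then_product)
    fix i
    show "continuous_on U (\<lambda>X. a i + (if i \<in> S then (b i - a i) * X (g i) else 0))"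
      by (cases "i \<in> S") (auto intro!: continuous_on_add continuous_on_mult continuous_on_const coord)
  qed
  have "\<exists>X\<in>U. \<forall>j<card S. f (y X) (h j) = 0"
    unfolding U_def
  proof (rule poincare_miranda_unit_cube; (unfold U_def[symmetric])?)
    fix j assume j: "j < card S"
    then have hj: "h j \<in> S" using h by (auto simp: bij_betw_def)
    show "continuous_on U (\<lambda>X. f (y X) (h j))"
      using continuous_on_compose2[OF cont[OF hj] ycont] yQ by auto
    fix X assume X: "X \<in> U"
    show "X j = 0 \<Longrightarrow> f (y X) (h j) \<ge> 0"
      using lo[OF yQ[OF X] hj] hj gh[OF j] by (simp add: y_def)
    show "X j = 1 \<Longrightarrow> f (y X) (h j) \<le> 0"
      using hi[OF yQ[OF X] hj] hj gh[OF j] by (simp add: y_def)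
  qed
  then obtain X where X: "X \<in> U" and zero: "\<And>j. j < card S \<Longrightarrow> f (y X) (h j) = 0"
    by blast
  have "f (y X) i = 0" if "i \<in> S" for i
    using zero[OF hg(2)[OF that]] hg(1)[OF that] by simp
  then show ?thesis using yQ[OF X] by blast
qed

section \<open>Orbits along cyclic coverings\<close>

text \<open>A zero of the vector field \<open>f\<close> below is a solution of all equations \<open>F (p i) = p (Suc i)\<close> at once;
  the covering conditions give its sign on the faces in the first coordinates, and the projection to \<open>B\<close>
  extends \<open>F\<close> from \<open>B\<close> to a box containing \<open>B\<close>.\<close>

lemma covering_loop_orbit:
  fixes F :: "real \<times> 'a::euclidean_space \<Rightarrow> real \<times> 'a" and l r :: "nat \<Rightarrow> real"
  assumes m: "0 < m" and lr: "\<And>i. i < m \<Longrightarrow> l i < r i" and per: "l m = l 0" "r m = r 0"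
    and B: "compact B" "convex B" "B \<noteq> {}"
    and cont: "\<And>i. i < m \<Longrightarrow> continuous_on ({l i..r i} \<times> B) F"
    and into: "\<And>i p. i < m \<Longrightarrow> p \<in> {l i..r i} \<times> B \<Longrightarrow> snd (F p) \<in> B"
    and cover: "\<And>i. i < m \<Longrightarrow>
       (\<forall>y\<in>B. fst (F (l i, y)) \<le> l (Suc i) \<and> r (Suc i) \<le> fst (F (r i, y))) \<or>
       (\<forall>y\<in>B. fst (F (r i, y)) \<le> l (Suc i) \<and> r (Suc i) \<le> fst (F (l i, y)))"
  shows "\<exists>p. p m = p 0 \<and> (\<forall>i<m. p i \<in> {l i..r i} \<times> B \<and> F (p i) = p (Suc i))"
proof -
  obtain C where C: "\<And>y. y \<in> B \<Longrightarrow> norm y \<le> C" "0 < C"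
    using compact_imp_bounded[OF B(1)] bounded_pos by blast
  \<comment> \<open>Cyclic successor and predecessor among the \<open>m\<close> positions.\<close>
  define nx where "nx i = Suc i mod m" for i
  define pv where "pv i = (if i = 0 then m - 1 else i - 1)" for i
  have nx: "nx i < m" "l (nx i) = l (Suc i)" "r (nx i) = r (Suc i)" "pv (nx i) = i" if "i < m" for i
    using that m per by (cases "Suc i = m"; auto simp: nx_def pv_def)+
  have pv: "pv i < m" if "i < m" for i
    using that by (auto simp: pv_def)
  \<comment> \<open>\<open>None\<close> indexes the horizontal coordinate, \<open>Some e\<close> the
    one along the basis vector \<open>e\<close>; positions from \<open>m\<close> on get the interval
    \<open>{0..0}\<close>.\<close>
  define a where "a = (\<lambda>(i, c :: 'a option). if i < m then (if c = None then l i else - C) else 0)"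
  define b where "b = (\<lambda>(i, c :: 'a option). if i < m then (if c = None then r i else C) else 0)"
  define Q where "Q = {X. \<forall>k. X k \<in> {a k..b k}}"
  define V where "V X i = (\<Sum>e\<in>Basis. X (i, Some e) *\<^sub>R e)" for X :: "nat \<times> 'a option \<Rightarrow> real" and i
  define P where "P X i = (X (i, None), closest_point B (V X i))" for X :: "nat \<times> 'a option \<Rightarrow> real" and i
  define up where "up i \<longleftrightarrow> (\<forall>y\<in>B. fst (F (l i, y)) \<le> l (Suc i) \<and> r (Suc i) \<le> fst (F (r i, y)))" for i
  \<comment> \<open>The horizontal component at \<open>i\<close> concerns the step leaving
    \<open>i\<close>, with a sign that compensates an orientation-reversing covering; the vertical
    component concerns the step arriving at \<open>i\<close>.\<close>
  define f where "f X = (\<lambda>(i, c). case c of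
      None \<Rightarrow> (if up i then 1 else - 1) * (X (nx i, None) - fst (F (P X i)))
    | Some e \<Rightarrow> snd (F (P X (pv i))) \<bullet> e - X (i, Some e))" for X
  define S where "S = {..<m} \<times> insert None (Some ` (Basis :: 'a set))"
  have Vb: "V X i \<bullet> e = X (i, Some e)" if "e \<in> Basis" for X i e
    using that by (simp add: V_def)
  have cpB: "closest_point B y \<in> B" for y
    using B by (simp add: closest_point_in_set compact_imp_closed)
  have QN: "X (i, None) \<in> {l i..r i}" if "X \<in> Q" "i < m" for X i
  proof -
    have "X (i, None) \<in> {a (i, None)..b (i, None)}" using that(1) unfolding Q_def by blast
    then show ?thesis using that(2) by (simp add: a_def b_def)
  qed
  have PQ: "P X i \<in> {l i..r i} \<times> B" if "X \<in> Q" "i < m" for X i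
    using QN[OF that] cpB by (simp add: P_def)
  have coord: "continuous_on Q (\<lambda>X. X k)" for k
    using continuous_on_product_then_coordinatewise[OF continuous_on_id] .
  have contV: "continuous_on Q (\<lambda>X. V X i)" for i
    unfolding V_def by (intro continuous_on_sum continuous_on_scaleR coord continuous_on_const)
  have contP: "continuous_on Q (\<lambda>X. P X i)" for i
    unfolding P_def
    using continuous_on_compose2[OF continuous_on_closest_point[OF B(2) compact_imp_closed[OF B(1)] B(3)] contV]
    by (intro continuous_on_Pair coord) auto
  have contF: "continuous_on Q (\<lambda>X. F (P X i))" if "i < m" for i
    using continuous_on_compose2[OF cont[OF that] contP] PQ that by auto
  have "\<exists>X\<in>Q. \<forall>k\<in>S. f X k = 0"
    unfolding Q_def
  proof (rule poincare_miranda; (unfold Q_def[symmetric])?)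
    show "finite S" by (simp add: S_def)
    show "a k \<le> b k" for k
      using lr C(2) by (cases k) (auto simp: a_def b_def less_imp_le)
    fix k assume "k \<in> S"
    then obtain i c where k: "k = (i, c)" "i < m" and c: "c = None \<or> (\<exists>e\<in>Basis. c = Some e)"
      by (auto simp: S_def)
    show "continuous_on Q (\<lambda>X. f X k)"
    proof (cases c)
      case None
      then show ?thesis using k contF[OF k(2)]
        by (simp add: f_def) (intro conjI impI continuous_on_diff continuous_on_fst coord)
    next
      case (Some e)
      then show ?thesis using k contF[OF pv[OF k(2)]]
        by (simp add: f_def) (intro continuous_on_inner continuous_on_diff continuous_on_const continuous_on_snd coord)
    qed
    fix X assume X: "X \<in> Q"
    have nxX: "X (nx i, None) \<in> {l (Suc i)..r (Suc i)}"
      using QN[OF X nx(1)[OF k(2)]] nx[OF k(2)] by simp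
    have inner: "\<bar>snd (F (P X (pv i))) \<bullet> e\<bar> \<le> C" if "e \<in> Basis" for e
      using C(1)[OF into[OF pv[OF k(2)] PQ[OF X pv[OF k(2)]]]] Basis_le_norm[OF that]
      by (meson order_trans)
    note cov = cover[OF k(2), folded up_def]
    have down: "\<forall>y\<in>B. fst (F (r i, y)) \<le> l (Suc i) \<and> r (Suc i) \<le> fst (F (l i, y))" if "\<not> up i"
      using cov that by blast
    have up: "\<forall>y\<in>B. fst (F (l i, y)) \<le> l (Suc i) \<and> r (Suc i) \<le> fst (F (r i, y))" if "up i"
      using that unfolding up_def .
    show "0 \<le> f X k" if "X k = a k"
    proof (cases c)
      case None
      then have "P X i = (l i, closest_point B (V X i))" using that k by (simp add: P_def a_def)
      then show ?thesis using None k nxX up down cpB[of "V X i"]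
        by (cases "up i") (fastforce simp: f_def)+
    next
      case (Some e)
      then show ?thesis using that k c inner[of e] by (simp add: f_def a_def)
    qed
    show "f X k \<le> 0" if "X k = b k"
    proof (cases c)
      case None
      then have "P X i = (r i, closest_point B (V X i))" using that k by (simp add: P_def b_def)
      then show ?thesis using None k nxX up down cpB[of "V X i"]
        by (cases "up i") (fastforce simp: f_def)+
    next
      case (Some e)
      then show ?thesis using that k c inner[of e] by (simp add: f_def b_def)
    qed
  qed
  then obtain X where X: "X \<in> Q" and zero: "\<And>k. k \<in> S \<Longrightarrow> f X k = 0" by blast
  have step: "F (P X i) = P X (nx i)" if i: "i < m" for i
  proof -
    have "f X (i, None) = 0" using zero[of "(i, None)"] i by (simp add: S_def)
    then have 1: "fst (F (P X i)) = X (nx i, None)" by (auto simp: f_def split: if_splits)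
    have "snd (F (P X i)) = V X (nx i)"
    proof (rule euclidean_eqI)
      fix e :: 'a assume e: "e \<in> Basis"
      then have "f X (nx i, Some e) = 0" using zero nx(1)[OF i] by (simp add: S_def)
      then show "snd (F (P X i)) \<bullet> e = V X (nx i) \<bullet> e"
        using e nx(4)[OF i] by (simp add: f_def Vb)
    qed
    \<comment> \<open>The vector \<open>V X (nx i)\<close> is a value of \<open>snd\<close> of
      \<open>F\<close>, hence lies in \<open>B\<close>, and the projection fixes it.\<close>
    then have "snd (F (P X i)) = closest_point B (V X (nx i))"
      using into[OF i PQ[OF X i]] by (simp add: closest_point_self)
    with 1 show ?thesis by (simp add: P_def prod_eq_iff)
  qed
  show ?thesis
  proof (intro exI conjI allI impI)
    show "P X (m mod m) = P X (0 mod m)" by simp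
    fix i assume i: "i < m"
    then show "P X (i mod m) \<in> {l i..r i} \<times> B" "F (P X (i mod m)) = P X (Suc i mod m)"
      using PQ[OF X i] step[OF i] by (simp_all add: nx_def)
  qed
qed

section \<open>Elementary loops of a cyclic orbit\<close>

lemma mod_Suc_cancel:
  assumes "0 < n" shows "Suc i mod n = Suc j mod n \<longleftrightarrow> i mod n = j mod n"
proof
  assume "Suc i mod n = Suc j mod n"
  then have "(Suc i + (n - 1)) mod n = (Suc j + (n - 1)) mod n"
    by (rule mod_add_cong) simp
  then show "i mod n = j mod n" using assms by simp
qed (rule mod_Suc_eq[symmetric, THEN trans, OF arg_cong[of _ _ "\<lambda>k. Suc k mod n"], THEN trans, OF _ mod_Suc_eq])

text \<open>A pair of indices stands for the interval spanned by the two corresponding orbit points, in either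
  order. Only the images of the endpoints matter for covering, because for the higher-dimensional map
  nothing else is known about an interval.\<close>

definition covers :: "(nat \<Rightarrow> 'a::linorder) \<Rightarrow> nat \<times> nat \<Rightarrow> nat \<times> nat \<Rightarrow> bool" where
  "covers x u v \<longleftrightarrow>
     min (x (Suc (fst u))) (x (Suc (snd u))) \<le> min (x (fst v)) (x (snd v)) \<and>
     max (x (fst v)) (x (snd v)) \<le> max (x (Suc (fst u))) (x (Suc (snd u)))"

text \<open>The weak inequalities allow a common endpoint; the intervals used for \<open>F\<close>
  stop short of the orbit points and so become disjoint.\<close>

definition separated :: "(nat \<Rightarrow> 'a::linorder) \<Rightarrow> nat \<times> nat \<Rightarrow> nat \<times> nat \<Rightarrow> bool" where
  "separated x u v \<longleftrightarrow>
     max (x (fst u)) (x (snd u)) \<le> min (x (fst v)) (x (snd v)) \<or>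
     max (x (fst v)) (x (snd v)) \<le> min (x (fst u)) (x (snd u))"

text \<open>Since \<open>v 0\<close> meets no other interval of the loop, a point that follows the loop cannot return
  before time \<open>m\<close>.\<close>

definition elementary_loop :: "(nat \<Rightarrow> 'a::linorder) \<Rightarrow> nat \<Rightarrow> (nat \<Rightarrow> nat \<times> nat) \<Rightarrow> bool" where
  "elementary_loop x m v \<longleftrightarrow> 0 < m \<and> v m = v 0 \<and>
     (\<forall>i<m. x (fst (v i)) \<noteq> x (snd (v i)) \<and> covers x (v i) (v (Suc i))) \<and>
     (\<forall>i. 0 < i \<and> i < m \<longrightarrow> separated x (v 0) (v i))"

text \<open>The dynamics is \<open>Suc\<close> on indices: \<open>x i\<close> moves to
  \<open>x (Suc i)\<close>, and indices count modulo \<open>n\<close>.\<close>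

locale cyclic_orbit =
  fixes x :: "nat \<Rightarrow> 'a::linorder" and n :: nat
  assumes n_pos: "0 < n" and eq_iff: "x i = x j \<longleftrightarrow> i mod n = j mod n"
begin

lemma Suc_eq_iff: "x (Suc i) = x (Suc j) \<longleftrightarrow> x i = x j"
  by (simp add: eq_iff mod_Suc_cancel n_pos)

lemma range_eq: "range x = x ` {..<n}"
proof -
  have "x i \<in> x ` {..<n}" for i
    by (rule image_eqI[of _ _ "i mod n"]) (auto simp: eq_iff n_pos)
  then show ?thesis by auto
qed

lemma finite_range: "finite (range x)"
  by (simp add: range_eq)

lemma card_range: "card (range x) = n"
  unfolding range_eq by (subst card_image) (auto simp: inj_on_def eq_iff)

text \<open>Take for \<open>x p\<close> the largest point that moves to the right and for
  \<open>x q\<close> the next point of the orbit, which must then move to the left.\<close>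

lemma ex_centre:
  assumes "2 \<le> n"
  shows "\<exists>p q. x p < x q \<and> x q \<le> x (Suc p) \<and> x (Suc q) \<le> x p \<and> (\<forall>i. x i \<le> x p \<or> x q \<le> x i)"
proof -
  have ne: "x (Suc i) \<noteq> x i" for i
    using assms by (auto simp: eq_iff mod_Suc split: if_splits)
  define A where "A = {x i |i. x i < x (Suc i)}"
  have finA: "finite A"
    by (rule finite_subset[OF _ finite_range]) (auto simp: A_def)
  \<comment> \<open>The smallest orbit point moves to the right, so \<open>A\<close> is
    nonempty.\<close>
  obtain i0 where i0: "x i0 = Min (range x)"
    using Min_in[OF finite_range] by force
  have "x i0 \<le> x (Suc i0)" unfolding i0 using Min_le[OF finite_range] by blast
  then have "x i0 \<in> A" using ne[of i0] unfolding A_def by (auto simp: less_le)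
  then have "Max A \<in> A" using Max_in[OF finA] by blast
  then obtain p where p: "x p = Max A" "x p < x (Suc p)" unfolding A_def by auto
  define B where "B = {x i |i. x p < x i}"
  have finB: "finite B"
    by (rule finite_subset[OF _ finite_range]) (auto simp: B_def)
  have "x (Suc p) \<in> B" using p(2) by (auto simp: B_def)
  then have "Min B \<in> B" using Min_in[OF finB] by blast
  then obtain q where q: "x q = Min B" "x p < x q" unfolding B_def by auto
  have gap: "x i \<le> x p \<or> x q \<le> x i" for i
  proof (cases "x p < x i")
    case True
    then have "x i \<in> B" by (auto simp: B_def)
    then show ?thesis using Min_le[OF finB] q(1) by simp
  qed (simp add: not_less)
  have "x q \<notin> A" using Max_ge[OF finA] p(1) q(2) by (metis not_le)
  then have "\<not> x q < x (Suc q)" unfolding A_def by blast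
  then have "x (Suc q) < x q" using ne[of q] by order
  then have "x (Suc q) \<le> x p" using gap[of "Suc q"] by auto
  moreover have "x q \<le> x (Suc p)" using gap[of "Suc p"] p(2) by auto
  ultimately show ?thesis using q(2) gap by blast
qed

end

section \<open>The two sides of the centre\<close>

locale centred_orbit = cyclic_orbit +
  fixes p q :: nat
  assumes pq: "x p < x q" and p_up: "x q \<le> x (Suc p)" and q_down: "x (Suc q) \<le> x p"
    and gap: "x i \<le> x p \<or> x q \<le> x i"
begin

definition left :: "nat \<Rightarrow> bool" where "left i \<longleftrightarrow> x i \<le> x p"

lemma not_left: "\<not> left i \<longleftrightarrow> x q \<le> x i"
  using gap[of i] pq unfolding left_def by (metis order.strict_trans2 not_le)

lemma leftD: "left i \<Longrightarrow> x i \<le> x p" and rightD: "\<not> left i \<Longrightarrow> x q \<le> x i"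
  by (simp add: left_def) (simp add: not_left)

text \<open>The centre covers itself; this is the case of period 1.\<close>

lemma fixed_loop: "elementary_loop x 1 (\<lambda>_. (p, q))"
  using pq p_up q_down by (auto simp: elementary_loop_def covers_def min_def max_def)

text \<open>The target of a step lies on the same side of the centre as the image of the source, and not
  beyond that image. A shortest chain of steps from the centre to a point that does not switch sides
  plays the role of the Stefan sequence of Burns and Hasselblatt.\<close>

definition step :: "nat \<Rightarrow> nat \<Rightarrow> bool" where
  "step i j \<longleftrightarrow> (left j \<and> x (Suc i) \<le> x j) \<or> (\<not> left j \<and> x j \<le> x (Suc i))"

definition chain :: "nat \<Rightarrow> (nat \<Rightarrow> nat) \<Rightarrow> bool" where
  "chain r w \<longleftrightarrow> x (w 0) \<in> {x p, x q} \<and> (\<forall>k<r. step (w k) (w (Suc k))) \<and>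
     left (w r) = left (Suc (w r))"

lemma step_left: "step i j \<Longrightarrow> left j = left (Suc i)"
  unfolding step_def by (auto simp: left_def)

text \<open>The orbit followed from \<open>p\<close> up to \<open>i\<close> is itself a chain;
  adding \<open>n * p\<close> to \<open>i\<close> makes this index come after
  \<open>p\<close>.\<close>

lemma ex_chain:
  assumes "left i = left (Suc i)" shows "\<exists>r w. chain r w"
proof -
  have ge: "p \<le> i + n * p" using n_pos by (simp add: trans_le_add2)
  have eq: "x (i + n * p) = x i" by (simp add: eq_iff)
  then have "x (Suc (i + n * p)) = x (Suc i)" by (simp only: Suc_eq_iff)
  with eq have "left (i + n * p) = left (Suc (i + n * p))" using assms by (simp add: left_def)
  then have "chain (i + n * p - p) (\<lambda>k. p + k)"
    using ge unfolding chain_def by (auto simp: step_def)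
  then show ?thesis by blast
qed

end

section \<open>Shortest chains\<close>

locale stefan_chain = centred_orbit +
  fixes r :: nat and w :: "nat \<Rightarrow> nat"
  assumes chain: "chain r w" and shortest: "chain r' w' \<Longrightarrow> r \<le> r'"
begin

lemma start: "x (w 0) = x p \<or> x (w 0) = x q"
  using chain by (auto simp: chain_def)

lemma step_w: "k < r \<Longrightarrow> step (w k) (w (Suc k))"
  using chain by (auto simp: chain_def)

lemma end_stays: "left (Suc (w r)) = left (w r)"
  using chain by (auto simp: chain_def)

text \<open>Otherwise the chain could end at \<open>k\<close> already.\<close>

lemma switch: "k < r \<Longrightarrow> left (Suc (w k)) \<longleftrightarrow> \<not> left (w k)"
  using shortest[of k w] chain by (auto simp: chain_def)

lemma alternate: "k < r \<Longrightarrow> left (w (Suc k)) \<longleftrightarrow> \<not> left (w k)"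
  using step_left[OF step_w] switch by blast

lemma alternate_twice: "j + 2 * d \<le> r \<Longrightarrow> left (w (j + 2 * d)) = left (w j)"
proof (induction d)
  case (Suc d)
  then show ?case using alternate[of "j + 2 * d"] alternate[of "Suc (j + 2 * d)"] by simp
qed simp

lemma alternate_even:
  assumes "k \<le> r" "j \<le> k" "even (k - j)" shows "left (w k) = left (w j)"
proof -
  obtain d where "k - j = 2 * d" using assms(3) by (elim evenE)
  then have "k = j + 2 * d" using assms(2) by simp
  then show ?thesis using alternate_twice[of j d] assms(1) by simp
qed

text \<open>Otherwise the chain could start at \<open>k\<close>.\<close>

lemma off_centre: "0 < k \<Longrightarrow> k \<le> r \<Longrightarrow> x (w k) \<noteq> x p \<and> x (w k) \<noteq> x q"
proof (rule ccontr)
  assume k: "0 < k" "k \<le> r" and "\<not> (x (w k) \<noteq> x p \<and> x (w k) \<noteq> x q)"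
  then have "chain (r - k) (\<lambda>i. w (i + k))"
    using step_w end_stays by (auto simp: chain_def)
  from shortest[OF this] k show False by simp
qed

text \<open>Jumping from \<open>j\<close> to \<open>k\<close> would omit the points between and give
  a shorter chain.\<close>

lemma no_shortcut: "Suc j < k \<Longrightarrow> k \<le> r \<Longrightarrow> \<not> step (w j) (w k)"
proof
  assume jk: "Suc j < k" "k \<le> r" and st: "step (w j) (w k)"
  define w' where "w' i = (if i \<le> j then w i else w (i + (k - Suc j)))" for i
  have "step (w' i) (w' (Suc i))" if "i < r - (k - Suc j)" for i
    using that jk st step_w[of i] step_w[of "i + (k - Suc j)"]
    by (cases "i < j"; cases "i = j") (auto simp: w'_def)
  moreover have "w' (r - (k - Suc j)) = w r" "w' 0 = w 0" using jk by (auto simp: w'_def)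
  ultimately have "chain (r - (k - Suc j)) w'"
    using start end_stays unfolding chain_def by auto
  from shortest[OF this] jk show False by simp
qed

text \<open>If \<open>w k\<close> were not farther out than \<open>w j\<close>, the step that
  reaches \<open>w j\<close> could reach \<open>w k\<close> directly, a shortcut. For
  \<open>j = 0\<close> the point \<open>w k\<close> would be a centre point.\<close>

lemma outward_left: "j < k \<Longrightarrow> k \<le> r \<Longrightarrow> left (w j) \<Longrightarrow> left (w k) \<Longrightarrow> x (w k) < x (w j)"
proof (rule ccontr)
  assume jk: "j < k" "k \<le> r" and l: "left (w j)" "left (w k)" and "\<not> x (w k) < x (w j)"
  then have le: "x (w j) \<le> x (w k)" by simp
  show False
  proof (cases j)
    case 0
    then have "x (w j) = x p" using start l(1) pq by (auto simp: left_def)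
    then show False using off_centre[of k] jk l le by (auto simp: left_def)
  next
    case (Suc i)
    then have "step (w i) (w k)"
      using step_w[of i] jk l le by (auto simp: step_def)
    then show False using no_shortcut[of i k] jk Suc by simp
  qed
qed

lemma outward_right: "j < k \<Longrightarrow> k \<le> r \<Longrightarrow> \<not> left (w j) \<Longrightarrow> \<not> left (w k) \<Longrightarrow> x (w j) < x (w k)"
proof (rule ccontr)
  assume jk: "j < k" "k \<le> r" and l: "\<not> left (w j)" "\<not> left (w k)" and "\<not> x (w j) < x (w k)"
  then have le: "x (w k) \<le> x (w j)" by simp
  show False
  proof (cases j)
    case 0
    then have "x (w j) = x q" using start l(1) by (auto simp: left_def)
    then show False using off_centre[of k] jk l le by (auto simp: not_left)
  next
    case (Suc i)
    then have "step (w i) (w k)"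
      using step_w[of i] jk l le by (auto simp: step_def)
    then show False using no_shortcut[of i k] jk Suc by simp
  qed
qed

text \<open>The chain visits \<open>r + 1\<close> distinct orbit points: those on one side move
  strictly outward.\<close>

lemma length_less: "r < n"
proof -
  have "inj_on (\<lambda>k. x (w k)) {..r}"
  proof (rule linorder_inj_onI)
    fix j k assume "j < k" "j \<in> {..r}" "k \<in> {..r}"
    then show "x (w j) \<noteq> x (w k)"
      using outward_left[of j k] outward_right[of j k] left_def[of "w j"] left_def[of "w k"]
      by (cases "left (w j)") auto
  qed auto
  then have "card ((\<lambda>k. x (w k)) ` {..r}) = Suc r" by (simp add: card_image)
  moreover have "card ((\<lambda>k. x (w k)) ` {..r}) \<le> card (range x)"
    by (rule card_mono[OF finite_range]) auto
  ultimately show ?thesis by (simp add: card_range)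
qed

text \<open>Both centre points switch sides, so no chain ends where it starts.\<close>

lemma length_pos: "0 < r"
proof (rule ccontr)
  assume "\<not> 0 < r"
  then have "left (Suc (w 0)) = left (w 0)" using end_stays by simp
  moreover have "x (Suc (w 0)) = x (Suc p) \<or> x (Suc (w 0)) = x (Suc q)"
    using start by (simp add: Suc_eq_iff)
  ultimately show False using start pq p_up q_down Suc_eq_iff[of "w 0" p] Suc_eq_iff[of "w 0" q]
    by (auto simp: left_def)
qed

text \<open>Writing \<open>I\<^sub>k\<close> for \<open>inner k\<close>, the intervals satisfy
  \<open>I\<^sub>0 \<rightarrow> I\<^sub>0 \<rightarrow> I\<^sub>1 \<rightarrow> \<dots> \<rightarrow> I\<^bsub>r-1\<^esub> \<rightarrow> outer\<close>, while \<open>outer\<close> covers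
  \<open>I\<^sub>0, I\<^bsub>r-1\<^esub>, I\<^bsub>r-3\<^esub>, \<dots>\<close> and meets no \<open>I\<^sub>k\<close>. Going through \<open>outer\<close> once gives loops of all lengths
  above \<open>r\<close> and of all even lengths up to \<open>r\<close>.\<close>

definition opp :: "nat \<Rightarrow> nat" where "opp i = (if left i then q else p)"
text \<open>The second end is the centre point on the other side, so each of these intervals
  contains the centre.\<close>

definition inner :: "nat \<Rightarrow> nat \<times> nat" where "inner k = (w k, opp (w k))"
text \<open>The end of \<open>outer\<close> nearer to the centre: the preceding chain point on the
  side of \<open>w r\<close>, or the centre point of that side if there is none.\<close>

definition pivot :: nat where "pivot = (if r = 1 then opp (w 0) else w (r - 2))"
definition outer :: "nat \<times> nat" where "outer = (w r, pivot)"

lemma left_opp: "left (opp i) \<longleftrightarrow> \<not> left i"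
  using pq by (auto simp: opp_def left_def)

text \<open>For \<open>r > 1\<close> outward monotonicity places \<open>pivot\<close>, and the step
  from \<open>w (r - 2)\<close> to \<open>w (r - 1)\<close> bounds its image; for
  \<open>r = 1\<close> it is \<open>p\<close>, whose image is at or beyond \<open>q\<close>.\<close>

lemma pivot_left:
  assumes "left (w r)"
  shows "x (w r) < x pivot" "left pivot" "x (w (r - 1)) \<le> x (Suc pivot)"
    "\<And>k. k < r \<Longrightarrow> left (w k) \<Longrightarrow> x pivot \<le> x (w k)"
proof -
  have r1: "\<not> left (w (r - 1))" using alternate[of "r - 1"] length_pos assms by simp
  have *: "x (w r) < x pivot \<and> left pivot \<and> x (w (r - 1)) \<le> x (Suc pivot) \<and>
    (\<forall>k<r. left (w k) \<longrightarrow> x pivot \<le> x (w k))"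
  proof (cases "r = 1")
    case True
    have "pivot = opp (w 0)" unfolding pivot_def if_P[OF True] ..
    then have "pivot = p" using r1 True by (simp add: opp_def)
    moreover have "x (w 0) = x q" using r1 start True by (auto simp: left_def)
    ultimately show ?thesis
      using True r1 p_up off_centre[of 1] assms by (auto simp: left_def)
  next
    case False
    then obtain s where s: "r = Suc (Suc s)"
      using length_pos by (metis One_nat_def not0_implies_Suc not_gr0)
    have zs: "pivot = w s" unfolding pivot_def if_not_P[OF False] by (simp add: s)
    have l: "left (w s)" using alternate[of s] r1 s by simp
    have "x (w k) \<ge> x (w s)" if "k < r" "left (w k)" for k
    proof -
      have "k \<noteq> Suc s" using r1 s that by auto
      then show ?thesis using outward_left[of k s] that l s by (cases "k = s") auto
    qed
    then show ?thesis
      using zs l outward_left[of s r] s assms step_w[of s] r1 by (auto simp: step_def)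
  qed
  show "x (w r) < x pivot" "left pivot" "x (w (r - 1)) \<le> x (Suc pivot)"
    "\<And>k. k < r \<Longrightarrow> left (w k) \<Longrightarrow> x pivot \<le> x (w k)" using * by auto
qed

lemma pivot_right:
  assumes "\<not> left (w r)"
  shows "x pivot < x (w r)" "\<not> left pivot" "x (Suc pivot) \<le> x (w (r - 1))"
    "\<And>k. k < r \<Longrightarrow> \<not> left (w k) \<Longrightarrow> x (w k) \<le> x pivot"
proof -
  have r1: "left (w (r - 1))" using alternate[of "r - 1"] length_pos assms by simp
  have *: "x pivot < x (w r) \<and> \<not> left pivot \<and> x (Suc pivot) \<le> x (w (r - 1)) \<and>
    (\<forall>k<r. \<not> left (w k) \<longrightarrow> x (w k) \<le> x pivot)"
  proof (cases "r = 1")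
    case True
    have "pivot = opp (w 0)" unfolding pivot_def if_P[OF True] ..
    then have "pivot = q" using r1 True by (simp add: opp_def)
    moreover have "x (w 0) = x p" using r1 start True pq by (auto simp: left_def)
    ultimately show ?thesis
      using True r1 q_down off_centre[of 1] rightD[OF assms] not_left[of q] by auto
  next
    case False
    then obtain s where s: "r = Suc (Suc s)"
      using length_pos by (metis One_nat_def not0_implies_Suc not_gr0)
    have zs: "pivot = w s" unfolding pivot_def if_not_P[OF False] by (simp add: s)
    have l: "\<not> left (w s)" using alternate[of s] r1 s by simp
    have "x (w k) \<le> x (w s)" if "k < r" "\<not> left (w k)" for k
    proof -
      have "k \<noteq> Suc s" using r1 s that by auto
      then show ?thesis using outward_right[of k s] that l s by (cases "k = s") auto
    qed
    then show ?thesis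
      using zs l outward_right[of s r] s assms step_w[of s] r1 by (auto simp: step_def)
  qed
  show "x pivot < x (w r)" "\<not> left pivot" "x (Suc pivot) \<le> x (w (r - 1))"
    "\<And>k. k < r \<Longrightarrow> \<not> left (w k) \<Longrightarrow> x (w k) \<le> x pivot" using * by auto
qed

lemma inner_nontrivial: "x (fst (inner k)) \<noteq> x (snd (inner k))"
  using left_opp[of "w k"] by (auto simp: inner_def left_def)

lemma outer_nontrivial: "x (fst outer) \<noteq> x (snd outer)"
  using pivot_left(1) pivot_right(1) by (cases "left (w r)") (auto simp: outer_def)

text \<open>The image of \<open>w k\<close> reaches at least to \<open>w (Suc k)\<close>, and the
  image of the opposite centre point lies across the centre.\<close>

lemma covers_inner:
  assumes "Suc k < r" shows "covers x (inner k) (inner (Suc k))"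
proof (cases "left (w k)")
  case True
  then have "\<not> left (w (Suc k))" "x (w (Suc k)) \<le> x (Suc (w k))"
    using alternate[of k] step_w[of k] assms by (auto simp: step_def)
  then show ?thesis
    using True q_down pq rightD[of "w (Suc k)"]
    by (auto simp: covers_def inner_def opp_def min_le_iff_disj le_max_iff_disj)
next
  case False
  then have "left (w (Suc k))" "x (Suc (w k)) \<le> x (w (Suc k))"
    using alternate[of k] step_w[of k] assms by (auto simp: step_def)
  then show ?thesis
    using False p_up pq leftD[of "w (Suc k)"]
    by (auto simp: covers_def inner_def opp_def min_le_iff_disj le_max_iff_disj)
qed

lemma covers_start: "covers x (inner 0) (inner 0)"
proof (cases "left (w 0)")
  case True
  then have "x (w 0) = x p" using start pq by (auto simp: left_def)
  moreover from this have "x (Suc (w 0)) = x (Suc p)" by (simp add: Suc_eq_iff)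
  ultimately show ?thesis using True pq p_up q_down by (auto simp: covers_def inner_def opp_def)
next
  case False
  then have "x (w 0) = x q" using start pq by (auto simp: left_def)
  moreover from this have "x (Suc (w 0)) = x (Suc q)" by (simp add: Suc_eq_iff)
  ultimately show ?thesis using False pq p_up q_down by (auto simp: covers_def inner_def opp_def)
qed

lemma covers_inner_outer: "covers x (inner (r - 1)) outer"
proof (cases "left (w r)")
  case True
  then have "\<not> left (w (r - 1))" "x (Suc (w (r - 1))) \<le> x (w r)"
    using alternate[of "r - 1"] step_w[of "r - 1"] length_pos by (auto simp: step_def)
  then show ?thesis
    using pivot_left(1,2)[OF True] p_up pq leftD[of pivot] leftD[OF True]
    by (auto simp: covers_def inner_def outer_def opp_def min_le_iff_disj le_max_iff_disj)
next
  case False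
  then have "left (w (r - 1))" "x (w r) \<le> x (Suc (w (r - 1)))"
    using alternate[of "r - 1"] step_w[of "r - 1"] length_pos by (auto simp: step_def)
  then show ?thesis
    using pivot_right(1,2)[OF False] q_down pq rightD[of pivot] rightD[OF False]
    by (auto simp: covers_def inner_def outer_def opp_def min_le_iff_disj le_max_iff_disj)
qed

text \<open>The point \<open>w r\<close> keeps its side while the image of \<open>pivot\<close>
  reaches at least to \<open>w (r - 1)\<close>. So the image spans the centre and all chain points
  on the side of \<open>w (r - 1)\<close>; \<open>inner 0\<close> is the centre itself.\<close>

lemma covers_outer_inner:
  assumes "k < r" and "k = 0 \<or> even (r - 1 - k)"
  shows "covers x outer (inner k)"
proof (cases "left (w r)")
  case True
  have l1: "\<not> left (w (r - 1))" using True alternate[of "r - 1"] length_pos by simp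
  have hi: "x (w (r - 1)) \<le> x (Suc pivot)" by (rule pivot_left(3)[OF True])
  have lo: "x (Suc (w r)) \<le> x p" using end_stays True by (simp add: left_def)
  have q1: "x q \<le> x (Suc pivot)" using rightD[OF l1] hi by simp
  consider "left (w k)" "x (w k) = x p" | "\<not> left (w k)" "x (w k) \<le> x (w (r - 1))"
  proof (cases "left (w k)")
    case l: True
    then have "k = 0" using assms alternate_even[of "r - 1" k] l1 by (cases "k = 0") simp_all
    then show ?thesis using l that(1) start pq by (auto simp: left_def)
  next
    case False
    then show ?thesis using that(2) outward_right[of k "r - 1"] l1 assms(1)
      by (cases "k = r - 1") (simp_all add: less_imp_le)
  qed
  then show ?thesis
  proof cases
    case 1
    then show ?thesis using lo q1 pq
      by (auto simp: covers_def inner_def outer_def opp_def min_le_iff_disj le_max_iff_disj)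
  next
    case 2
    then show ?thesis using lo q1 hi pq rightD[of "w k"]
      by (auto simp: covers_def inner_def outer_def opp_def min_le_iff_disj le_max_iff_disj)
  qed
next
  case False
  have l1: "left (w (r - 1))" using False alternate[of "r - 1"] length_pos by simp
  have lo: "x (Suc pivot) \<le> x (w (r - 1))" by (rule pivot_right(3)[OF False])
  have hi: "x q \<le> x (Suc (w r))" using end_stays False by (simp add: not_left[symmetric])
  have p1: "x (Suc pivot) \<le> x p" using leftD[OF l1] lo by simp
  consider "\<not> left (w k)" "x (w k) = x q" | "left (w k)" "x (w (r - 1)) \<le> x (w k)"
  proof (cases "left (w k)")
    case l: False
    then have "k = 0" using assms alternate_even[of "r - 1" k] l1 by (cases "k = 0") simp_all
    then show ?thesis using l that(1) start pq by (auto simp: left_def)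
  next
    case True
    then show ?thesis using that(2) outward_left[of k "r - 1"] l1 assms(1)
      by (cases "k = r - 1") (simp_all add: less_imp_le)
  qed
  then show ?thesis
  proof cases
    case 1
    then show ?thesis using hi p1 pq
      by (auto simp: covers_def inner_def outer_def opp_def min_le_iff_disj le_max_iff_disj)
  next
    case 2
    then show ?thesis using lo p1 hi pq leftD[of "w k"]
      by (auto simp: covers_def inner_def outer_def opp_def min_le_iff_disj le_max_iff_disj)
  qed
qed

text \<open>On the side of \<open>w r\<close>, no \<open>inner k\<close> extends beyond
  \<open>pivot\<close>, where \<open>outer\<close> begins.\<close>

lemma separated_outer_inner:
  assumes "k < r" shows "separated x outer (inner k)"
proof (cases "left (w r)")
  case True
  then show ?thesis
    using pivot_left(1,2)[OF True] pivot_left(4)[OF True assms] leftD[of pivot] rightD[of "w k"] pq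
    by (cases "left (w k)") (auto simp: separated_def outer_def inner_def opp_def)
next
  case False
  then show ?thesis
    using pivot_right(1,2)[OF False] pivot_right(4)[OF False assms] rightD[of pivot] leftD[of "w k"] pq
    by (cases "left (w k)") (auto simp: separated_def outer_def inner_def opp_def)
qed

text \<open>Here \<open>g\<close> lists the inner intervals visited between two visits to
  \<open>outer\<close>: possibly waiting at \<open>inner 0\<close>, then climbing one by one to
  \<open>inner (r - 1)\<close>.\<close>

lemma elementary_loopI:
  assumes m: "1 < m" and "\<And>i. 0 < i \<Longrightarrow> i < m \<Longrightarrow> g i < r"
    and "g 1 = 0 \<or> even (r - 1 - g 1)" and "g (m - 1) = r - 1"
    and "\<And>i. 0 < i \<Longrightarrow> Suc i < m \<Longrightarrow> g (Suc i) = Suc (g i) \<or> g i = 0 \<and> g (Suc i) = 0"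
  shows "\<exists>v. elementary_loop x m v"
proof -
  define v where "v i = (if i = 0 \<or> m \<le> i then outer else inner (g i))" for i
  have "covers x (v i) (v (Suc i))" if "i < m" for i
  proof -
    have "i = 0 \<or> (0 < i \<and> Suc i < m) \<or> (0 < i \<and> i = m - 1)" using that by linarith
    then consider "i = 0" | "0 < i" "Suc i < m" | "0 < i" "i = m - 1" by blast
    then show ?thesis
    proof cases
      case 1
      then show ?thesis using m covers_outer_inner[of "g 1"] assms by (auto simp: v_def)
    next
      case 2
      then show ?thesis
        using assms(2)[of "Suc i"] assms(5)[of i] covers_inner[of "g i"] covers_start
        by (auto simp: v_def)
    next
      case 3
      then show ?thesis using covers_inner_outer assms by (auto simp: v_def)
    qed
  qed
  then have "elementary_loop x m v"
    using m assms(2) inner_nontrivial outer_nontrivial separated_outer_inner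
    by (auto simp: elementary_loop_def v_def)
  then show ?thesis by blast
qed

lemma ex_loop_long:
  assumes "r < m" shows "\<exists>v. elementary_loop x m v"
  \<comment> \<open>Truncated subtraction makes the loop wait at \<open>inner 0\<close> before it
    climbs.\<close>
  by (rule elementary_loopI[where g = "\<lambda>i. i - (m - r)"]) (use assms length_pos in auto)

lemma ex_loop_even:
  assumes "even m" "0 < m" shows "\<exists>v. elementary_loop x m v"
proof (cases "r < m")
  case False
  have "1 < m" using assms by (cases "m = 1") auto
  then show ?thesis using False assms
    \<comment> \<open>From \<open>outer\<close> the loop enters \<open>inner (r - m + 1)\<close>
      directly, allowed because \<open>m - 2\<close> is even.\<close>
    by (intro elementary_loopI[where g = "\<lambda>i. r - m + i"]) auto
qed (rule ex_loop_long)

end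

section \<open>Both alternatives: a point that keeps its side, or halving the orbit\<close>

context centred_orbit
begin

lemma ex_loop_non_switching:
  assumes "left i = left (Suc i)" and "n < m \<or> even m \<and> 0 < m"
  shows "\<exists>v. elementary_loop x m v"
proof -
  define r where "r = (LEAST r. \<exists>w. chain r w)"
  have "\<exists>r w. chain r w" by (rule ex_chain[OF assms(1)])
  then have "\<exists>w. chain r w" unfolding r_def by (rule LeastI_ex)
  then obtain w where w: "chain r w" ..
  interpret stefan_chain x n p q r w
    by unfold_locales (use w in \<open>auto simp: r_def intro: Least_le\<close>)
  show ?thesis using assms(2) ex_loop_long ex_loop_even length_less by auto
qed

lemma switching_parity:
  assumes "\<And>i. left (Suc i) \<longleftrightarrow> \<not> left i"
  shows "left i \<longleftrightarrow> left 0 = even i"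
  by (induction i) (auto simp: assms)

lemma switching_even:
  assumes "\<And>i. left (Suc i) \<longleftrightarrow> \<not> left i"
  shows "even n"
proof -
  have "x n = x 0" by (simp add: eq_iff)
  then have "left n = left 0" by (simp add: left_def)
  then show ?thesis using switching_parity[OF assms, of n] by auto
qed

lemma half_orbit:
  assumes "even n" shows "cyclic_orbit (\<lambda>i. x (2 * i)) (n div 2)"
proof
  show "0 < n div 2" using assms n_pos by (auto elim: evenE)
  fix i j
  obtain k where "n = 2 * k" using assms by (auto elim: evenE)
  then show "x (2 * i) = x (2 * j) \<longleftrightarrow> i mod (n div 2) = j mod (n div 2)"
    by (simp add: eq_iff flip: mult_mod_right)
qed

text \<open>After each interval of the given loop its image pair is inserted. The inserted pairs lie
  on the other side of the centre, so they are separated from the first interval.\<close>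

lemma double_loop:
  assumes sw: "\<And>i. left (Suc i) \<longleftrightarrow> \<not> left i"
    and v: "elementary_loop (\<lambda>i. x (2 * i)) m v"
  shows "\<exists>v'. elementary_loop x (2 * m) v'"
proof -
  define v' where "v' i = (let (a, b) = v (i div 2) in
     if even i then (2 * a, 2 * b) else (Suc (2 * a), Suc (2 * b)))" for i
  have ev: "v' (2 * j) = (2 * fst (v j), 2 * snd (v j))"
    and od: "v' (Suc (2 * j)) = (Suc (2 * fst (v j)), Suc (2 * snd (v j)))" for j
    by (simp_all add: v'_def split: prod.split)
  have ev': "v' (Suc (Suc (2 * j))) = (2 * fst (v (Suc j)), 2 * snd (v (Suc j)))" for j
    using ev[of "Suc j"] by simp
  have vv: "x (2 * fst (v j)) \<noteq> x (2 * snd (v j))"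
    "covers (\<lambda>i. x (2 * i)) (v j) (v (Suc j))" if "j < m" for j
    using v that unfolding elementary_loop_def by blast+
  have body: "x (fst (v' i)) \<noteq> x (snd (v' i)) \<and> covers x (v' i) (v' (Suc i))" if "i < 2 * m" for i
  proof (cases "even i")
    case True
    then obtain j where "i = 2 * j" by (elim evenE)
    then show ?thesis using vv[of j] that by (simp add: ev od covers_def)
  next
    case False
    then obtain j where "i = Suc (2 * j)" by (auto elim: oddE)
    then show ?thesis using vv[of j] that by (simp add: ev' od covers_def Suc_eq_iff)
  qed
  have par: "left i \<longleftrightarrow> left 0 = even i" for i
    by (rule switching_parity[OF sw])
  have sep: "separated x (v' 0) (v' i)" if "0 < i" "i < 2 * m" for i
  proof (cases "even i")
    case True
    then obtain j where "i = 2 * j" by (elim evenE)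
    then show ?thesis using v that ev[of 0]
      by (simp add: ev elementary_loop_def separated_def)
  next
    case False
    then obtain j where j: "i = Suc (2 * j)" by (auto elim: oddE)
    have le: "x a \<le> x b" if "left a" "\<not> left b" for a b
      using leftD[OF that(1)] rightD[OF that(2)] pq by order
    have "left (2 * a) = left 0" "left (Suc (2 * a)) = (\<not> left 0)" for a
      using par[of "2 * a"] par[of "Suc (2 * a)"] by auto
    then show ?thesis using ev[of 0] j le
      by (cases "left 0") (simp_all add: od separated_def)
  qed
  have "0 < m" "v m = v 0" using v by (simp_all add: elementary_loop_def)
  then have "v' (2 * m) = v' 0" using ev[of 0] ev[of m] by simp
  with \<open>0 < m\<close> have "elementary_loop x (2 * m) v'"
    using body sep by (simp add: elementary_loop_def)
  then show ?thesis by blast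
qed

end

text \<open>Strong induction on \<open>n\<close>: halving lowers both exponents of 2 by one and so
  preserves the Sharkovskii relation.\<close>

theorem sharkovskii_loop:
  fixes x :: "nat \<Rightarrow> 'a::linorder"
  assumes "cyclic_orbit x n" and "n \<triangleleft> m"
  shows "\<exists>v. elementary_loop x m v"
  using assms
proof (induction n arbitrary: x m rule: less_induct)
  case (less n)
  interpret cyclic_orbit x n by (rule less.prems)
  obtain a p b q where nm: "n = 2 ^ a * p" "odd p" "m = 2 ^ b * q" "odd q"
    and ord: "p > 1 \<and> q > 1 \<and> (a < b \<or> a = b \<and> p < q) \<or> p > 1 \<and> q = 1 \<or> p = 1 \<and> q = 1 \<and> a > b"
    using less.prems(2) unfolding sharkovskii_def by blast
  have "0 < m" using nm by (auto intro!: Nat.gr0I)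
  have "2 \<le> n"
  proof -
    have "n \<noteq> 1" using nm(1) ord by auto
    then show ?thesis using n_pos by simp
  qed
  then obtain c d where "centred_orbit x n c d"
    using ex_centre by (metis centred_orbit_axioms.intro centred_orbit_def cyclic_orbit_axioms)
  then interpret centred_orbit x n c d .
  show ?case
  proof (cases "m = 1")
    case True
    then show ?thesis using fixed_loop by blast
  next
    case m1: False
    show ?thesis
    proof (cases "\<exists>i. left i = left (Suc i)")
      case True
      \<comment> \<open>If \<open>m\<close> is odd and not 1, then the order forces
        \<open>a = b = 0\<close> and \<open>p < q\<close>.\<close>
      moreover have "n < m \<or> even m"
        using nm ord m1 by (cases "b = 0") auto
      ultimately show ?thesis using ex_loop_non_switching \<open>0 < m\<close> by blast
    next
      case False
      then have sw: "left (Suc i) \<longleftrightarrow> \<not> left i" for i by blast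
      have "even n" by (rule switching_even[OF sw])
      then obtain a' where a': "a = Suc a'" using nm by (cases a) auto
      \<comment> \<open>For even \<open>n\<close>, the only odd number that succeeds it is 1, which
        is excluded here.\<close>
      then obtain b' where b': "b = Suc b'" using nm(3) m1 ord by (cases b) auto
      have "n div 2 \<triangleleft> 2 ^ b' * q"
        unfolding sharkovskii_def
        by (rule exI[of _ a'], rule exI[of _ p], rule exI[of _ b'], rule exI[of _ q])
          (use nm ord a' b' in auto)
      then obtain v where "elementary_loop (\<lambda>i. x (2 * i)) (2 ^ b' * q) v"
        using less.IH[OF _ half_orbit[OF \<open>even n\<close>]] n_pos by auto
      then show ?thesis using double_loop[OF sw] nm(3) b' by (simp add: mult.assoc)
    qed
  qed
qed

section \<open>Periodic points of the map\<close>

theorem theorem2: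
  fixes F :: "real \<times> (real ^ 'd) \<Rightarrow> real \<times> (real ^ 'd)"
    and I :: "real set" and R :: real and n m :: nat
    and x \<delta> :: "nat \<Rightarrow> real" and y :: "nat \<Rightarrow> real ^ 'd"
  assumes "is_interval I" and "closed I" and "0 < R"
    and "continuous_on (I \<times> cball 0 R) F"
    and "F ` (I \<times> cball 0 R) \<subseteq> interior (I \<times> cball 0 R)"
    and "has_least_period F n (x 0, y 0)"
    and "\<forall>i\<le>n. (x i, y i) = (F ^^ i) (x 0, y 0)"
    and "\<forall>i\<le>n. (x i, y i) \<in> interior I \<times> cball 0 R"
    and "\<forall>i\<le>n. 0 < \<delta> i" and "\<delta> n = \<delta> 0"
    and "\<forall>i<n. {x i - \<delta> i..x i + \<delta> i} \<subseteq> I"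
    and "disjoint_family_on (\<lambda>i. {x i - \<delta> i..x i + \<delta> i}) {..<n}"
    and "\<forall>i<n. F ` ({x i - \<delta> i..x i + \<delta> i} \<times> cball 0 R)
           \<subseteq> {x (i + 1) - \<delta> (i + 1)<..<x (i + 1) + \<delta> (i + 1)} \<times> ball 0 R"
    and "n \<triangleleft> m"
  shows "\<exists>p \<in> I \<times> cball 0 R. has_least_period F m p"
proof -
  define X where "X i = x (i mod n)" for i
  define \<Delta> where "\<Delta> i = \<delta> (i mod n)" for i
  have n: "0 < n" and xn: "x n = x 0"
    using assms(6) assms(7)[rule_format, of n] by (auto simp: has_least_period_def)
  have Suc_mod: "X (Suc i) = x (i mod n + 1)" "\<Delta> (Suc i) = \<delta> (i mod n + 1)" for i
    using xn assms(10) by (auto simp: X_def \<Delta>_def mod_Suc)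
  have \<Delta>_pos: "0 < \<Delta> i" for i
    using assms(9) n by (simp add: \<Delta>_def less_imp_le)
  have disj: "{X i - \<Delta> i..X i + \<Delta> i} \<inter> {X j - \<Delta> j..X j + \<Delta> j} = {}" if "i mod n \<noteq> j mod n" for i j
    using disjoint_family_onD[OF assms(12), of "i mod n" "j mod n"] n that
    by (simp add: X_def \<Delta>_def)
  have eq_iff: "X i = X j \<longleftrightarrow> i mod n = j mod n" for i j
  proof
    assume eq: "X i = X j"
    have "X i \<in> {X i - \<Delta> i..X i + \<Delta> i} \<inter> {X j - \<Delta> j..X j + \<Delta> j}"
      using \<Delta>_pos[of i] \<Delta>_pos[of j] eq by simp
    then show "i mod n = j mod n" using disj by blast
  qed (simp add: X_def)
  interpret cyclic_orbit X n
    using n eq_iff by unfold_locales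
  have sep: "X i + \<Delta> i < X j - \<Delta> j" if "X i < X j" for i j
  proof (rule ccontr)
    assume "\<not> X i + \<Delta> i < X j - \<Delta> j"
    \<comment> \<open>Overlapping neighbourhoods would share this point.\<close>
    then have "max (X i) (X j - \<Delta> j) \<in> {X i - \<Delta> i..X i + \<Delta> i} \<inter> {X j - \<Delta> j..X j + \<Delta> j}"
      using that \<Delta>_pos[of i] \<Delta>_pos[of j] by auto
    moreover have "i mod n \<noteq> j mod n" using that eq_iff[of i j] by auto
    ultimately show False using disj by blast
  qed
  have mono: "X i + \<Delta> i \<le> X j + \<Delta> j" "X i - \<Delta> i \<le> X j - \<Delta> j" if "X i \<le> X j" for i j
  proof -
    have "\<Delta> i = \<Delta> j" if "X i = X j" using that eq_iff by (simp add: \<Delta>_def)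
    then show "X i + \<Delta> i \<le> X j + \<Delta> j" "X i - \<Delta> i \<le> X j - \<Delta> j"
      using that sep[of i j] \<Delta>_pos[of i] \<Delta>_pos[of j] by (cases "X i = X j"; simp)+
  qed
  have subI: "{X i - \<Delta> i..X i + \<Delta> i} \<subseteq> I" for i
    using assms(11) n by (simp add: X_def \<Delta>_def)
  have mapJ: "fst (F (t, u)) \<in> {X (Suc i) - \<Delta> (Suc i)<..<X (Suc i) + \<Delta> (Suc i)}"
    if "t \<in> {X i - \<Delta> i..X i + \<Delta> i}" "u \<in> cball 0 R" for i t u
  proof -
    have "F (t, u) \<in> F ` ({x (i mod n) - \<delta> (i mod n)..x (i mod n) + \<delta> (i mod n)} \<times> cball 0 R)"
      using that by (auto simp: X_def \<Delta>_def)
    moreover have "i mod n < n" using n by simp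
    ultimately have "F (t, u) \<in> {x (i mod n + 1) - \<delta> (i mod n + 1)<..<x (i mod n + 1) + \<delta> (i mod n + 1)} \<times> ball 0 R"
      using assms(13) by blast
    then show ?thesis unfolding Suc_mod mem_Times_iff ..
  qed
  obtain v where "elementary_loop X m v"
    using sharkovskii_loop[OF cyclic_orbit_axioms assms(14)] by blast
  then have m: "0 < m" and vm: "v m = v 0" and nontriv: "\<And>i. i < m \<Longrightarrow> X (fst (v i)) \<noteq> X (snd (v i))"
    and cov: "\<And>i. i < m \<Longrightarrow> covers X (v i) (v (Suc i))"
    and separ: "\<And>i. 0 < i \<Longrightarrow> i < m \<Longrightarrow> separated X (v 0) (v i)"
    by (simp_all add: elementary_loop_def)
  define a where "a i = (if X (fst (v i)) \<le> X (snd (v i)) then fst (v i) else snd (v i))" for i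
  define b where "b i = (if X (fst (v i)) \<le> X (snd (v i)) then snd (v i) else fst (v i))" for i
  have Xa: "min (X (fst (v i))) (X (snd (v i))) = X (a i)"
    and Xb: "max (X (fst (v i))) (X (snd (v i))) = X (b i)" for i
    by (auto simp: a_def b_def)
  have ab: "X (a i) < X (b i)" if "i < m" for i
    using nontriv[OF that] by (auto simp: a_def b_def)
  have cov': "min (X (Suc (a i))) (X (Suc (b i))) \<le> X (a (Suc i))"
    "X (b (Suc i)) \<le> max (X (Suc (a i))) (X (Suc (b i)))" if "i < m" for i
    using cov[OF that] unfolding covers_def Xa Xb
    by (auto simp: a_def b_def min.commute max.commute split: if_splits)
  \<comment> \<open>The gap between the two neighbourhoods; its ends belong to them, so
    \<open>mapJ\<close> controls \<open>F\<close> on the fibres there.\<close>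
  define l where "l i = X (a i) + \<Delta> (a i)" for i
  define r where "r i = X (b i) - \<Delta> (b i)" for i
  have lI: "l i \<in> {X (a i) - \<Delta> (a i)..X (a i) + \<Delta> (a i)}"
    and rI: "r i \<in> {X (b i) - \<Delta> (b i)..X (b i) + \<Delta> (b i)}" for i
    using \<Delta>_pos[of "a i"] \<Delta>_pos[of "b i"] by (auto simp: l_def r_def)
  have "l i \<in> I" "r i \<in> I" for i
    using lI rI subI by blast+
  then have lrI: "{l i..r i} \<times> cball 0 R \<subseteq> I \<times> cball 0 R" for i
    using mem_is_interval_1_I[OF assms(1)] by fastforce
  have "\<exists>p. p m = p 0 \<and> (\<forall>i<m. p i \<in> {l i..r i} \<times> cball 0 R \<and> F (p i) = p (Suc i))"
  proof (rule covering_loop_orbit[OF m])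
    show "l m = l 0" "r m = r 0" using vm by (simp_all add: l_def r_def a_def b_def)
    show "compact (cball (0 :: real ^ 'd) R)" "convex (cball (0 :: real ^ 'd) R)" "cball (0 :: real ^ 'd) R \<noteq> {}"
      using assms(3) by auto
    fix i assume i: "i < m"
    show "l i < r i" using sep[OF ab[OF i]] by (simp add: l_def r_def)
    show "continuous_on ({l i..r i} \<times> cball 0 R) F"
      using continuous_on_subset[OF assms(4) lrI] .
    show "snd (F q) \<in> cball 0 R" if "q \<in> {l i..r i} \<times> cball 0 R" for q
    proof -
      have "F q \<in> F ` (I \<times> cball 0 R)" by (rule imageI[OF subsetD[OF lrI that]])
      then have "F q \<in> I \<times> cball 0 R" using assms(5) interior_subset by fast
      then show ?thesis by (rule mem_Times_iff[THEN iffD1, THEN conjunct2])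
    qed
    have l_img: "X (Suc (a i)) - \<Delta> (Suc (a i)) < fst (F (l i, u)) \<and> fst (F (l i, u)) < X (Suc (a i)) + \<Delta> (Suc (a i))"
      and r_img: "X (Suc (b i)) - \<Delta> (Suc (b i)) < fst (F (r i, u)) \<and> fst (F (r i, u)) < X (Suc (b i)) + \<Delta> (Suc (b i))"
      if "u \<in> cball 0 R" for u
      using mapJ[OF lI that] mapJ[OF rI that] by simp_all
    show "(\<forall>u\<in>cball 0 R. fst (F (l i, u)) \<le> l (Suc i) \<and> r (Suc i) \<le> fst (F (r i, u))) \<or>
      (\<forall>u\<in>cball 0 R. fst (F (r i, u)) \<le> l (Suc i) \<and> r (Suc i) \<le> fst (F (l i, u)))"
    \<comment> \<open>The order of the images of the two ends decides the orientation of the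
      covering.\<close>
    proof (cases "X (Suc (a i)) \<le> X (Suc (b i))")
      case True
      then have "X (Suc (a i)) + \<Delta> (Suc (a i)) \<le> l (Suc i)" "r (Suc i) \<le> X (Suc (b i)) - \<Delta> (Suc (b i))"
        unfolding l_def r_def using cov'[OF i] mono by simp_all
      with l_img r_img show ?thesis
        by (intro disjI1 ballI) fastforce
    next
      case False
      then have "X (Suc (b i)) + \<Delta> (Suc (b i)) \<le> l (Suc i)" "r (Suc i) \<le> X (Suc (a i)) - \<Delta> (Suc (a i))"
        unfolding l_def r_def using cov'[OF i] mono by simp_all
      with l_img r_img show ?thesis
        by (intro disjI2 ballI) fastforce
    qed
  qed
  then obtain p where pm: "p m = p 0"
    and p: "\<And>i. i < m \<Longrightarrow> p i \<in> {l i..r i} \<times> cball 0 R" "\<And>i. i < m \<Longrightarrow> F (p i) = p (Suc i)" by blast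
  have iter: "(F ^^ k) (p 0) = p k" if "k \<le> m" for k
    using that by (induction k) (simp_all add: p(2))
  \<comment> \<open>An earlier return would put \<open>p 0\<close> over both interval 0 and interval
    \<open>k\<close>, which neighbourhoods of positive width keep apart.\<close>
  have "(F ^^ k) (p 0) \<noteq> p 0" if k: "0 < k" "k < m" for k
  proof
    assume "(F ^^ k) (p 0) = p 0"
    then have eq: "p k = p 0" using iter k by simp
    have "fst (p 0) \<in> {l 0..r 0}" "fst (p 0) \<in> {l k..r k}"
      using p(1)[OF m] p(1)[OF k(2)] eq by (auto simp: mem_Times_iff)
    moreover have "X (b 0) \<le> X (a k) \<or> X (b k) \<le> X (a 0)"
      using separ[OF k] by (simp only: separated_def Xa Xb)
    ultimately show False
      using \<Delta>_pos[of "a 0"] \<Delta>_pos[of "b 0"] \<Delta>_pos[of "a k"] \<Delta>_pos[of "b k"]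
      by (auto simp: l_def r_def)
  qed
  then have "has_least_period F m (p 0)"
    using m iter[of m] pm by (simp add: has_least_period_def)
  moreover have "p 0 \<in> I \<times> cball 0 R"
    by (rule subsetD[OF lrI p(1)[OF m]])
  ultimately show ?thesis by (rule bexI)
qed

end
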